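(* Let $G$ be a planar ($g=0$) Feynman graph with grade $\ell>3$ and with $\varphi$ $\mathrm{O}(D)$-loops. (1) If $\ell>\varphi+2$, then the $\mathrm{O}(D)$-loop configuration of $G$ is a partition $p(2(\ell+2i),i+1)$ for some $i\in\{0,\dots,\ell-4\}$; that is, $\varphi=i+1$ and the lengths of the $\mathrm{O}(D)$-loops are $i+1$ even positive integers with sum $2(\ell+2i)$. (2) Otherwise, $G$ either contains an $\mathrm{O}(D)$-loop of length $2$, or has $\mathrm{O}(D)$-loop configuration of the form $\bigl(4,4,\dots,4,\,p(2(\ell+2(i-1)),i)^{>2}\bigr)$ for some $i\in\{1,\dots,\ell-2\}$; that is, up to reordering, $\varphi-i$ of the $\mathrm{O}(D)$-loops have length $4$ and the remaining $i$ loops have even lengths, each greater than $2$, with sum $2(\ell+2(i-1))$.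
   Context: A planar Feynman graph is a connected 4-regular map on the sphere (self-loops and multiple edges allowed), with edges directed so that around each vertex the half-edges alternate ingoing, outgoing, ingoing, outgoing. Let $v\ge1$ be the number of vertices; the number of edges is $2v$. An $\mathrm{O}(D)$-loop is a closed walk that goes straight at each vertex (it leaves through the half-edge opposite to the one through which it arrives); every edge lies in exactly one $\mathrm{O}(D)$-loop, and the length of such a loop is its number of edges. $\varphi$ is the number of $\mathrm{O}(D)$-loops and the $\mathrm{O}(D)$-loop configuration is the (unordered) tuple $(l_1,\dots,l_\varphi)$ of their lengths. With $g=0$, the grade $\ell$ is defined by $\frac{\ell}{2}=1+\frac v2-\varphi$. The notation $p(n,m)=(p_1,\dots,p_m)$ denotes a partition $n=\sum_{i=1}^m p_i$ of $n$ into $m$ even positive integers, and $p(n,m)^{>k}$ one in which each $p_i$ is greater than $k$. *)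

theory Defs
  imports "HOL-Combinatorics.Orbits" "HOL-Library.Multiset"
begin

text \<open>
  Maps on closed oriented surfaces are encoded by rotation systems. The darts are the half-edges;
  \<open>rot\<close> sends a half-edge to the next one in cyclic order around its vertex, and \<open>opp\<close> sends it to
  the other half of its edge. Vertices, edges and faces are the orbits of \<open>rot\<close>, \<open>opp\<close> and
  \<open>rot \<circ> opp\<close>. The predicate \<open>outgoing\<close> records the direction of the edges: every edge has one half
  that is outgoing (at its source) and one that is not (the ingoing half at its target).
\<close>

record 'a omap =
  darts :: "'a set"
  rot :: "'a \<Rightarrow> 'a"
  opp :: "'a \<Rightarrow> 'a"
  outgoing :: "'a \<Rightarrow> bool"

definition vertices :: "'a omap \<Rightarrow> 'a set set" where
  "vertices G = orbit (rot G) ` darts G"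

definition edges :: "'a omap \<Rightarrow> 'a set set" where
  "edges G = (\<lambda>d. {d, opp G d}) ` darts G"

definition faces :: "'a omap \<Rightarrow> 'a set set" where
  "faces G = orbit (rot G \<circ> opp G) ` darts G"

definition map_connected :: "'a omap \<Rightarrow> bool" where
  "map_connected G \<longleftrightarrow>
     (\<forall>x\<in>darts G. \<forall>y\<in>darts G.
        (x, y) \<in> ({(d, rot G d) | d. d \<in> darts G} \<union> {(d, opp G d) | d. d \<in> darts G})\<^sup>*)"

definition euler_char :: "'a omap \<Rightarrow> int" where
  "euler_char G = int (card (vertices G)) - int (card (edges G)) + int (card (faces G))"

text \<open>
  The genus \<open>g\<close> of a connected map satisfies \<open>euler_char G = 2 - 2 * g\<close>, so the last condition
  says that the surface is the sphere.
\<close>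

definition planar_feynman_graph :: "'a omap \<Rightarrow> bool" where
  "planar_feynman_graph G \<longleftrightarrow>
     finite (darts G) \<and> darts G \<noteq> {} \<and>
     rot G permutes darts G \<and>
     opp G permutes darts G \<and>
     (\<forall>d\<in>darts G. opp G d \<noteq> d \<and> opp G (opp G d) = d) \<and>
     (\<forall>d\<in>darts G. card (orbit (rot G) d) = 4) \<and>
     (\<forall>d\<in>darts G. outgoing G (opp G d) \<longleftrightarrow> \<not> outgoing G d) \<and>
     (\<forall>d\<in>darts G. outgoing G (rot G d) \<longleftrightarrow> \<not> outgoing G d) \<and>
     map_connected G \<and>
     euler_char G = 2"

text \<open>
  A walk that has just left a vertex through the half-edge \<open>d\<close> arrives at the next vertex through
  \<open>opp G d\<close> and, going straight, leaves it through the opposite half-edge, two positions further on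
  in the cyclic order.
\<close>

definition straight :: "'a omap \<Rightarrow> 'a \<Rightarrow> 'a" where
  "straight G d = rot G (rot G (opp G d))"

text \<open>
  A loop is identified with the set of edges it traverses, so that a closed walk and its reversal
  give the same loop. A straight walk never traverses an edge in both directions, so the number of
  its steps, the length of the loop, is the cardinality of this set.
\<close>

definition od_loop :: "'a omap \<Rightarrow> 'a \<Rightarrow> 'a set set" where
  "od_loop G d = (\<lambda>e. {e, opp G e}) ` orbit (straight G) d"

definition od_loops :: "'a omap \<Rightarrow> 'a set set set" where
  "od_loops G = od_loop G ` darts G"

definition num_loops :: "'a omap \<Rightarrow> nat" where
  "num_loops G = card (od_loops G)"

definition od_config :: "'a omap \<Rightarrow> nat multiset" where
  "od_config G = image_mset card (mset_set (od_loops G))"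

text \<open>
  This is \<open>l / 2 = 1 + v / 2 - \<phi>\<close> (the genus 0 case) multiplied by 2, where \<open>v\<close> and \<open>\<phi>\<close> are the
  numbers of vertices and loops.
\<close>

definition grade :: "'a omap \<Rightarrow> int" where
  "grade G = 2 + int (card (vertices G)) - 2 * int (num_loops G)"

text \<open>\<open>even_partition n m P\<close> states that \<open>P\<close> is a partition \<open>p(n, m)\<close>.\<close>

definition even_partition :: "nat \<Rightarrow> nat \<Rightarrow> nat multiset \<Rightarrow> bool" where
  "even_partition n m P \<longleftrightarrow> size P = m \<and> sum_mset P = n \<and> (\<forall>x\<in>#P. even x \<and> 0 < x)"

end

theory Submission
  imports Defs
begin

text \<open>
  Every loop has even length because a straight walk alternates between outgoing and ingoing
  half-edges, and the lengths add up to the number of edges \<open>2 * v = 4 * \<phi> + 2 * (l - 2)\<close>. If no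
  length is \<open>2\<close>, each loop uses at least \<open>4\<close> of this total; a loop of length other than \<open>4\<close> uses
  at least \<open>2\<close> more, so there are between \<open>1\<close> and \<open>l - 2\<close> of them.
\<close>

section \<open>Orbits of permutations and a parity criterion\<close>

text \<open>The iterates before the first return to \<open>x\<close> are distinct and exhaust the
  orbit, so its size is the return time.\<close>

lemma funpow_card_orbit:
  assumes "x \<in> orbit f x"
  shows "(f ^^ card (orbit f x)) x = x"
proof -
  have "card (orbit f x) = card ((\<lambda>n. (f ^^ n) x) ` {0..<funpow_dist1 f x x})"
    using orbit_conv_funpow_dist1[OF assms] by simp
  also have "\<dots> = funpow_dist1 f x x"
    by (simp add: card_image[OF inj_on_funpow_dist1[OF assms]])
  finally show ?thesis
    using funpow_dist1_prop[OF assms] by simp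
qed

lemma card_orbit_partition:
  assumes "finite S" "f permutes S" "\<And>x. x \<in> S \<Longrightarrow> card (orbit f x) = k"
  shows "card S = k * card (orbit f ` S)"
proof -
  have perm: "permutation f"
    using assms permutation_permutes by blast
  have "\<Union> (orbit f ` S) = S"
    using permutes_orbit_subset[OF assms(2)] permutation_self_in_orbit[OF perm] by blast
  moreover have "orbit f x \<inter> orbit f y = {}" if "orbit f x \<noteq> orbit f y" for x y
    using that orbit_cyclic_eq3[OF cyclic_on_orbit'[OF perm]] by blast
  then have "k * card (orbit f ` S) = card (\<Union> (orbit f ` S))"
    using assms(1,3) finite_orbit[OF permutation_self_in_orbit[OF perm]]
    by (intro card_partition) auto
  ultimately show ?thesis
    by simp
qed

text \<open>\<open>f\<close> maps the elements satisfying \<open>P\<close> bijectively onto the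
  remaining ones, so \<open>A\<close> splits into two halves of equal size.\<close>

lemma even_card_if_alternating:
  assumes "finite A" "inj_on f A" "f ` A = A" "\<And>x. x \<in> A \<Longrightarrow> P (f x) \<longleftrightarrow> \<not> P x"
  shows "even (card A)"
proof -
  define B where "B = {x \<in> A. P x}"
  have "f ` B = A - B"
  proof
    show "f ` B \<subseteq> A - B"
      using assms(3,4) unfolding B_def by blast
    show "A - B \<subseteq> f ` B"
    proof
      fix y assume y: "y \<in> A - B"
      then obtain x where "x \<in> A" "y = f x"
        using assms(3) by blast
      with y show "y \<in> f ` B"
        using assms(4) unfolding B_def by blast
    qed
  qed
  moreover have "B \<subseteq> A"
    by (auto simp: B_def)
  ultimately have "card (A - B) = card B"
    using assms(2) by (metis card_image inj_on_subset)
  moreover have "card A = card B + card (A - B)"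
    using \<open>B \<subseteq> A\<close> assms(1) by (metis card_Diff_subset card_mono finite_subset le_add_diff_inverse)
  ultimately show ?thesis
    by simp
qed

section \<open>Local structure of the map\<close>

locale feynman_graph =
  fixes G :: "'a omap"
  assumes planar_feynman_graph: "planar_feynman_graph G"
begin

lemma finite_darts: "finite (darts G)"
  and darts_nonempty: "darts G \<noteq> {}"
  and rot_permutes: "rot G permutes darts G"
  and opp_permutes: "opp G permutes darts G"
  and opp_neq: "d \<in> darts G \<Longrightarrow> opp G d \<noteq> d"
  and opp_opp: "d \<in> darts G \<Longrightarrow> opp G (opp G d) = d"
  and card_orbit_rot: "d \<in> darts G \<Longrightarrow> card (orbit (rot G) d) = 4"
  and outgoing_opp: "d \<in> darts G \<Longrightarrow> outgoing G (opp G d) \<longleftrightarrow> \<not> outgoing G d"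
  and outgoing_rot: "d \<in> darts G \<Longrightarrow> outgoing G (rot G d) \<longleftrightarrow> \<not> outgoing G d"
  using planar_feynman_graph unfolding planar_feynman_graph_def by blast+

lemma rot_in_darts: "d \<in> darts G \<Longrightarrow> rot G d \<in> darts G"
  using rot_permutes by (simp add: permutes_in_image)

lemma opp_in_darts: "d \<in> darts G \<Longrightarrow> opp G d \<in> darts G"
  using opp_permutes by (simp add: permutes_in_image)

section \<open>Straight walks and their reversal\<close>

lemma straight_permutes: "straight G permutes darts G"
proof -
  have "straight G = rot G \<circ> rot G \<circ> opp G"
    by (auto simp: straight_def)
  then show ?thesis
    using permutes_compose rot_permutes opp_permutes by metis
qed

lemma permutation_straight: "permutation (straight G)"
  using straight_permutes finite_darts permutation_permutes by blast

lemma straight_in_darts: "d \<in> darts G \<Longrightarrow> straight G d \<in> darts G"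
  using straight_permutes by (simp add: permutes_in_image)

lemma orbit_straight_subset: "d \<in> darts G \<Longrightarrow> orbit (straight G) d \<subseteq> darts G"
  by (rule permutes_orbit_subset[OF straight_permutes])

text \<open>A straight step applies \<open>opp\<close> once and \<open>rot\<close> twice; each flips
  the direction, and three flips amount to one.\<close>

lemma outgoing_straight: "d \<in> darts G \<Longrightarrow> outgoing G (straight G d) \<longleftrightarrow> \<not> outgoing G d"
  by (simp add: straight_def outgoing_rot outgoing_opp rot_in_darts opp_in_darts)

text \<open>A fixed point of the half-turn would have an orbit of at most two darts, against the
  degree four.\<close>

lemma rot_rot_neq:
  assumes "d \<in> darts G"
  shows "rot G (rot G d) \<noteq> d"
proof
  assume eq: "rot G (rot G d) = d"
  have "x \<in> {d, rot G d}" if "x \<in> orbit (rot G) d" for x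
    using that by induction (auto simp: eq)
  then have "orbit (rot G) d \<subseteq> {d, rot G d}"
    by blast
  then have "card (orbit (rot G) d) \<le> card {d, rot G d}"
    by (rule card_mono[rotated]) simp
  also have "\<dots> \<le> 2"
    by (simp add: card_insert_if)
  finally show False
    using card_orbit_rot[OF assms] by simp
qed

lemma rot_rot_rot_rot:
  assumes "d \<in> darts G"
  shows "rot G (rot G (rot G (rot G d))) = d"
proof -
  have "d \<in> orbit (rot G) d"
    using permutation_self_in_orbit rot_permutes finite_darts permutation_permutes by metis
  from funpow_card_orbit[OF this] show ?thesis
    by (simp add: card_orbit_rot[OF assms] eval_nat_numeral)
qed

text \<open>Time reversal: the two occurrences of \<open>opp\<close> in the middle cancel, and the
  two half-turns that then meet make a full turn. Hence \<open>opp\<close> conjugates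
  \<open>straight G\<close> to its inverse.\<close>

lemma straight_opp_straight:
  assumes "d \<in> darts G"
  shows "straight G (opp G (straight G d)) = opp G d"
  using assms
  by (simp add: straight_def opp_opp rot_rot_rot_rot rot_in_darts opp_in_darts)

text \<open>
  Removing a step at either end shortens a walk from \<open>d\<close> to \<open>opp G d\<close> until it has length
  \<open>0\<close> or \<open>1\<close>, which is excluded as neither \<open>opp\<close> nor the half-turn at a vertex has a fixed point.
\<close>

lemma funpow_straight_neq_opp:
  assumes "d \<in> darts G"
  shows "(straight G ^^ n) d \<noteq> opp G d"
  using assms
proof (induction n arbitrary: d rule: less_induct)
  case (less n)
  consider "n = 0" | "n = 1" | m where "n = Suc (Suc m)"
    by (metis One_nat_def not0_implies_Suc)
  then show ?case
  proof cases
    case 1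
    then show ?thesis
      using opp_neq[OF less.prems] by simp
  next
    case 2
    then show ?thesis
      using rot_rot_neq[OF opp_in_darts[OF less.prems]] by (simp add: straight_def)
  next
    case 3
    show ?thesis
    proof
      assume "(straight G ^^ n) d = opp G d"
      then have "straight G ((straight G ^^ m) (straight G d))
          = straight G (opp G (straight G d))"
        using straight_opp_straight[OF less.prems] by (simp add: 3 funpow_swap1)
      then have "(straight G ^^ m) (straight G d) = opp G (straight G d)"
        using permutes_inj[OF straight_permutes] by (simp add: inj_eq)
      then show False
        using less.IH[of m "straight G d"] straight_in_darts[OF less.prems] 3 by simp
    qed
  qed
qed

text \<open>By the reversal symmetry \<open>opp\<close> carries orbits of \<open>straight G\<close>
  to orbits of its inverse, and a permutation has the same orbits as its inverse.\<close>

lemma orbit_straight_opp: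
  assumes "d \<in> darts G"
  shows "orbit (straight G) (opp G d) = opp G ` orbit (straight G) d"
proof -
  have "inv (straight G) (opp G x) = opp G (straight G x)" if "x \<in> darts G" for x
    using straight_opp_straight[OF that] permutes_inj[OF straight_permutes]
    by (metis inv_f_f)
  then have "opp G ` orbit (straight G) d = orbit (inv (straight G)) (opp G d)"
    using orbit_straight_subset[OF assms]
    by (intro orbit_inverse permutation_self_in_orbit permutation_straight) blast
  then show ?thesis
    by (simp add: orbit_inv_eq[OF permutation_straight])
qed

section \<open>Loops as a partition of the edges\<close>

text \<open>The reversed walk meets the same edges through their other halves, and an edge is an
  unordered pair of halves.\<close>

lemma od_loop_opp:
  assumes "d \<in> darts G"
  shows "od_loop G (opp G d) = od_loop G d"
  unfolding od_loop_def orbit_straight_opp[OF assms] image_image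
  using orbit_straight_subset[OF assms]
  by (intro image_cong refl) (auto simp: opp_opp subset_iff)

lemma od_loop_eq:
  assumes "e \<in> orbit (straight G) d"
  shows "od_loop G e = od_loop G d"
  unfolding od_loop_def
  using orbit_cyclic_eq3[OF cyclic_on_orbit'[OF permutation_straight] assms] by simp

lemma edge_eq_iff:
  "{d, opp G d} = {e, opp G e} \<longleftrightarrow> e = d \<or> e = opp G d" if "d \<in> darts G" "e \<in> darts G"
  using that by (auto simp: doubleton_eq_iff opp_opp)

text \<open>The walk from \<open>d\<close> contains one half of the edge, either \<open>e\<close> or
  \<open>opp G e\<close>; both generate the same loop. This is what makes distinct loops
  disjoint.\<close>

lemma edge_in_od_loopD:
  assumes "d \<in> darts G" "e \<in> darts G" "{e, opp G e} \<in> od_loop G d"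
  shows "od_loop G e = od_loop G d"
proof -
  obtain x where x: "x \<in> orbit (straight G) d" "{e, opp G e} = {x, opp G x}"
    using assms(3) unfolding od_loop_def by blast
  then have "x \<in> darts G"
    using orbit_straight_subset assms(1) by blast
  then have "od_loop G x = od_loop G e"
    using x(2) edge_eq_iff[OF assms(2)] od_loop_opp assms(2) by metis
  then show ?thesis
    using od_loop_eq[OF x(1)] by simp
qed

lemma od_loop_subset_edges: "d \<in> darts G \<Longrightarrow> od_loop G d \<subseteq> edges G"
  unfolding od_loop_def edges_def using orbit_straight_subset by blast

lemma finite_edges: "finite (edges G)"
  unfolding edges_def using finite_darts by simp

lemma finite_od_loops: "finite (od_loops G)"
  unfolding od_loops_def using finite_darts by simp

lemma Union_od_loops: "\<Union> (od_loops G) = edges G"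
proof
  show "\<Union> (od_loops G) \<subseteq> edges G"
    using od_loop_subset_edges unfolding od_loops_def by blast
  show "edges G \<subseteq> \<Union> (od_loops G)"
    unfolding edges_def od_loops_def od_loop_def
    using permutation_self_in_orbit[OF permutation_straight] by blast
qed

lemma disjoint_od_loops: "pairwise disjnt (od_loops G)"
proof (rule pairwiseI)
  fix L M assume "L \<in> od_loops G" "M \<in> od_loops G" and neq: "L \<noteq> M"
  then obtain c d where cd: "c \<in> darts G" "d \<in> darts G" "L = od_loop G c" "M = od_loop G d"
    unfolding od_loops_def by blast
  show "disjnt L M"
  proof (rule ccontr)
    assume "\<not> disjnt L M"
    then obtain E where E: "E \<in> L" "E \<in> M"
      unfolding disjnt_def by blast
    then obtain e where "e \<in> darts G" "E = {e, opp G e}"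
      using od_loop_subset_edges cd unfolding edges_def by blast
    then show False
      using edge_in_od_loopD E cd neq by metis
  qed
qed

text \<open>Two darts of one orbit are never the two halves of an edge, by
  \<open>funpow_straight_neq_opp\<close>, so different steps of the walk use different edges. This
  moves questions of length to orbits.\<close>

lemma card_od_loop:
  assumes "d \<in> darts G"
  shows "card (od_loop G d) = card (orbit (straight G) d)"
  unfolding od_loop_def
proof (rule card_image, rule inj_onI)
  fix x y
  assume x: "x \<in> orbit (straight G) d" and y: "y \<in> orbit (straight G) d"
    and eq: "{x, opp G x} = {y, opp G y}"
  have darts: "x \<in> darts G" "y \<in> darts G"
    using x y orbit_straight_subset[OF assms] by blast+
  have "y \<in> orbit (straight G) x"
    using x y orbit_cyclic_eq3[OF cyclic_on_orbit'[OF permutation_straight]] by blast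
  then have "y \<noteq> opp G x"
    using funpow_straight_neq_opp[OF darts(1)] by (auto simp: orbit_altdef)
  then show "x = y"
    using eq edge_eq_iff[OF darts] by blast
qed

lemma even_card_od_loop:
  assumes "L \<in> od_loops G"
  shows "even (card L)"
proof -
  obtain d where d: "d \<in> darts G" "L = od_loop G d"
    using assms unfolding od_loops_def by blast
  let ?O = "orbit (straight G) d"
  have fin: "finite ?O"
    using finite_orbit permutation_self_in_orbit[OF permutation_straight] by metis
  have inj: "inj_on (straight G) ?O"
    using permutes_inj[OF straight_permutes] inj_on_subset by blast
  have "straight G ` ?O = ?O"
    by (rule endo_inj_surj[OF fin _ inj]) (auto intro: orbit.step)
  then have "even (card ?O)"
    using fin inj orbit_straight_subset[OF d(1)] outgoing_straight
    by (intro even_card_if_alternating[where P = "outgoing G"]) blast+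
  then show ?thesis
    using card_od_loop d by simp
qed

lemma card_od_loop_pos:
  assumes "L \<in> od_loops G"
  shows "card L > 0"
proof -
  have "finite L"
    using assms Union_od_loops finite_edges by (metis Union_upper finite_subset)
  moreover have "L \<noteq> {}"
    using assms unfolding od_loops_def od_loop_def by (auto simp: orbit_nonempty)
  ultimately show ?thesis
    by (simp add: card_gt_0_iff)
qed

section \<open>Counting edges and loop lengths\<close>

text \<open>Double counting of darts: four at each vertex, two on each edge.\<close>

lemma card_edges: "card (edges G) = 2 * card (vertices G)"
proof -
  have "card (darts G) = 4 * card (vertices G)"
    unfolding vertices_def
    by (rule card_orbit_partition[OF finite_darts rot_permutes card_orbit_rot])
  moreover have "card (darts G) = 2 * card (edges G)"
  proof -
    have "2 * card (edges G) = card (\<Union> (edges G))"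
    proof (rule card_partition)
      show "finite (\<Union> (edges G))"
        unfolding edges_def using finite_darts by simp
      show "card E = 2" if "E \<in> edges G" for E
        using that opp_neq unfolding edges_def by (force simp: card_2_iff)
      have edge_eq: "E = {z, opp G z}" if "E \<in> edges G" "z \<in> E" for E z
        using that opp_opp unfolding edges_def by auto
      show "E \<inter> F = {}" if "E \<in> edges G" "F \<in> edges G" "E \<noteq> F" for E F
        using that edge_eq by blast
    qed (rule finite_edges)
    also have "\<Union> (edges G) = darts G"
      unfolding edges_def using opp_in_darts by blast
    finally show ?thesis ..
  qed
  ultimately show ?thesis
    by simp
qed

lemma sum_mset_od_config: "sum_mset (od_config G) = 2 * card (vertices G)"
proof -
  have "sum_mset (od_config G) = sum card (od_loops G)"
    by (simp add: od_config_def sum_unfold_sum_mset)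
  also have "\<dots> = card (\<Union> (od_loops G))"
    using card_Union_disjoint[OF disjoint_od_loops] Union_od_loops finite_edges
    by (metis Union_upper finite_subset)
  finally show ?thesis
    by (simp add: Union_od_loops card_edges)
qed

lemma size_od_config: "size (od_config G) = num_loops G"
  by (simp add: od_config_def num_loops_def)

lemma set_od_config: "set_mset (od_config G) = card ` od_loops G"
  by (simp add: od_config_def finite_od_loops)

lemma even_pos_od_config: "x \<in># od_config G \<Longrightarrow> even x \<and> 0 < x"
  unfolding set_od_config using even_card_od_loop card_od_loop_pos by auto

lemma num_loops_pos: "num_loops G > 0"
  using darts_nonempty finite_darts
  by (auto simp: num_loops_def od_loops_def card_gt_0_iff)

end

theorem theorem6:
  fixes G :: "'a omap" and l :: nat
  assumes "planar_feynman_graph G"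
    and "grade G = int l"
    and "l > 3"
  shows
    "(l > num_loops G + 2 \<longrightarrow>
       (\<exists>i\<in>{0..l - 4}. num_loops G = i + 1 \<and>
          even_partition (2 * (l + 2 * i)) (i + 1) (od_config G))) \<and>
     (\<not> l > num_loops G + 2 \<longrightarrow>
       (\<exists>L\<in>od_loops G. card L = 2) \<or>
       (\<exists>i\<in>{1..l - 2}. i \<le> num_loops G \<and>
          (\<exists>P. even_partition (2 * (l + 2 * (i - 1))) i P \<and> (\<forall>x\<in>#P. x > 2) \<and>
               od_config G = replicate_mset (num_loops G - i) 4 + P)))"
proof -
  interpret feynman_graph G
    using assms(1) by unfold_locales
  \<comment> \<open>Twice the grade equation, arranged without subtraction so that it can be stated
    in \<open>nat\<close>.\<close>
  have total: "sum_mset (od_config G) + 4 = 2 * l + 4 * num_loops G"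
    using assms(2) unfolding sum_mset_od_config grade_def by linarith
  show ?thesis
  proof (intro conjI impI)
    assume "l > num_loops G + 2"
    \<comment> \<open>The witness is one less than the number of loops; there is at least one loop,
      so the subtraction is not truncated.\<close>
    then have "num_loops G - 1 \<in> {0..l - 4}" "num_loops G = num_loops G - 1 + 1"
      using num_loops_pos by auto
    moreover have "even_partition (2 * (l + 2 * (num_loops G - 1))) (num_loops G - 1 + 1)
        (od_config G)"
      unfolding even_partition_def
      using total num_loops_pos size_od_config even_pos_od_config by auto
    ultimately show "\<exists>i\<in>{0..l - 4}. num_loops G = i + 1 \<and>
        even_partition (2 * (l + 2 * i)) (i + 1) (od_config G)"
      by blast
  next
    show "(\<exists>L\<in>od_loops G. card L = 2) \<or>
       (\<exists>i\<in>{1..l - 2}. i \<le> num_loops G \<and>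
          (\<exists>P. even_partition (2 * (l + 2 * (i - 1))) i P \<and> (\<forall>x\<in>#P. x > 2) \<and>
               od_config G = replicate_mset (num_loops G - i) 4 + P))"
    proof (cases "2 \<in># od_config G")
      case True
      then show ?thesis
        unfolding set_od_config by force
    next
      case False
      \<comment> \<open>\<open>P\<close> collects the lengths other than \<open>4\<close>, and
        \<open>i\<close> counts them.\<close>
      define P where "P = filter_mset (\<lambda>x. x \<noteq> 4) (od_config G)"
      define i where "i = size P"
      have "od_config G = filter_mset (\<lambda>x. x = 4) (od_config G) + P"
        unfolding P_def by (rule multiset_partition)
      then have split: "od_config G = replicate_mset (count (od_config G) 4) 4 + P"
        by (simp add: filter_eq_replicate_mset)
      have count: "count (od_config G) 4 + i = num_loops G"
        using arg_cong[OF split, of size] by (simp add: size_od_config i_def)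
      have "sum_mset (od_config G) = 4 * count (od_config G) 4 + sum_mset P"
        using arg_cong[OF split, of sum_mset] by simp
      \<comment> \<open>Each loop of length \<open>4\<close> contributes \<open>4\<close> to both
        sides of \<open>total\<close>, so these loops cancel.\<close>
      then have sum_P: "sum_mset P + 4 = 2 * l + 4 * i"
        using total count by linarith
      have P_ge: "x \<ge> 6" and P_even: "even x" if "x \<in># P" for x
      proof -
        have x: "even x" "0 < x" "x \<noteq> 2" "x \<noteq> 4"
          using that False even_pos_od_config by (auto simp: P_def)
        then show "even x" "x \<ge> 6"
          by presburger+
      qed
      \<comment> \<open>Combined with \<open>sum_P\<close>, the bound
        \<open>6 * i \<le> sum_mset P\<close> gives \<open>2 * i + 4 \<le> 2 * l\<close>, that is
        \<open>i \<le> l - 2\<close>.\<close>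
      have "sum_mset (image_mset (\<lambda>_. 6) P) \<le> sum_mset (image_mset (\<lambda>x. x) P)"
        using P_ge by (rule sum_mset_mono)
      then have "6 * i \<le> sum_mset P"
        by (simp add: i_def mult.commute)
      \<comment> \<open>An empty \<open>P\<close> would force \<open>l = 2\<close> in
        \<open>sum_P\<close>.\<close>
      moreover have "i \<noteq> 0"
        using sum_P assms(3) by (auto simp: i_def)
      ultimately have i: "i \<in> {1..l - 2}"
        using sum_P assms(3) by auto
      have "even_partition (2 * (l + 2 * (i - 1))) i P" "\<forall>x\<in>#P. x > 2"
        unfolding even_partition_def
        using sum_P \<open>i \<noteq> 0\<close> P_even P_ge by (fastforce simp: i_def)+
      then show ?thesis
        using i split count by (metis add_diff_cancel_right' le_add2)
    qed
  qed
qed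

end
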